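(* Let $\mathcal{X}$, $\mathcal{Y}$ and $\mathcal{Z}$ be three separable Hilbert spaces, and let $A\subseteq\mathcal{X}\times\mathcal{Z}$ and $B\subseteq\mathcal{Y}\times\mathcal{Z}$ be two range space relations such that $\mathrm{dom}(A)$, $\mathrm{ran}(B)$ and $\ker(B)$ are closed. Then there is a bounded linear operator $T\subseteq\mathcal{X}\times\mathcal{Y}$ such that $A=BT$ if and only if $\mathrm{ran}(A)\subseteq\mathrm{ran}(B)$ and $\mathrm{mul}(B)=\mathrm{mul}(A)$.
   Context: A linear relation in $\mathcal{X}\times\mathcal{Y}$ is a linear subspace $A\subseteq\mathcal{X}\times\mathcal{Y}$. One sets $\mathrm{dom}(A)=\{x:\exists y,\ (x,y)\in A\}$, $\mathrm{ran}(A)=\{y:\exists x,\ (x,y)\in A\}$, $\ker(A)=\{x:(x,0)\in A\}$, $\mathrm{mul}(A)=\{y:(0,y)\in A\}$. For linear relations $A\subseteq\mathcal{X}\times\mathcal{Y}$ and $B\subseteq\mathcal{Y}\times\mathcal{Z}$, the product is $BA=\{(x,z):\exists y\in\mathcal{Y},\ (x,y)\in A \text{ and } (y,z)\in B\}\subseteq\mathcal{X}\times\mathcal{Z}$. A linear relation $A$ is (the graph of) a linear operator, defined on $\mathrm{dom}(A)$, if and only if $\mathrm{mul}(A)=\{0\}$; linear operators are identified with their graphs. A bounded linear operator $T\subseteq\mathcal{X}\times\mathcal{Y}$ is a linear relation that is the graph of a linear operator $\mathrm{dom}(T)\to\mathcal{Y}$ which is bounded on $\mathrm{dom}(T)$ (the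 domain $\mathrm{dom}(T)\subseteq\mathcal{X}$ need not be all of $\mathcal{X}$). For Hilbert spaces $\mathcal{X},\mathcal{Y}$, a linear relation $A\subseteq\mathcal{X}\times\mathcal{Y}$ is a range space relation if there are a Hilbert space $\mathcal{W}$ and a bounded linear operator $F:\mathcal{W}\to\mathcal{X}\times\mathcal{Y}$ (defined on all of $\mathcal{W}$) with $\mathrm{ran}(F)=A$. *)

theory Defs
  imports "HOL-Analysis.Analysis"
begin

text \<open>
  The scalar field of a Hilbert space is \<open>\<real>\<close> or \<open>\<complex>\<close>. The class below has exactly these two
  models (up to isomorphism), so that both cases are treated at once; all spaces occurring in one
  statement share the same scalar field.
\<close>

class real_or_complex = real_normed_field +
  fixes to_complex :: "'a \<Rightarrow> complex"
  assumes to_complex_add: "to_complex (a + b) = to_complex a + to_complex b"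
    and to_complex_mult: "to_complex (a * b) = to_complex a * to_complex b"
    and to_complex_scaleR: "to_complex (r *\<^sub>R a) = r *\<^sub>R to_complex a"
    and norm_to_complex: "norm (to_complex a) = norm a"
    and range_to_complex: "range to_complex = \<real> \<or> range to_complex = UNIV"

instantiation real :: real_or_complex
begin
definition to_complex_real :: "real \<Rightarrow> complex" where "to_complex_real = complex_of_real"
instance by standard (auto simp: to_complex_real_def Reals_def scaleR_conv_of_real)
end

instantiation complex :: real_or_complex
begin
definition to_complex_complex :: "complex \<Rightarrow> complex" where "to_complex_complex = (\<lambda>z. z)"
instance by standard (auto simp: to_complex_complex_def)
end

text \<open>
  A Hilbert space over \<open>'k\<close>. Every Hilbert space over \<open>\<real>\<close> or \<open>\<complex>\<close> is a complete real inner product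
  space for the real part of its inner product, with the same norm; the sort of \<open>'a\<close> provides this
  underlying real structure (and hence norm, topology and completeness), and \<open>ip\<close> is the
  \<open>'k\<close>-valued inner product, linear in its first argument.
\<close>

locale hilbert_space = vector_space scale
  for scale :: "'k::real_or_complex \<Rightarrow> 'a::{real_inner, complete_space} \<Rightarrow> 'a" +
  fixes ip :: "'a \<Rightarrow> 'a \<Rightarrow> 'k"
  assumes scale_of_real: "scale (of_real r) x = r *\<^sub>R x"
    and ip_add_left: "ip (x + y) z = ip x z + ip y z"
    and ip_scale_left: "ip (scale a x) y = a * ip x y"
    and ip_commute: "to_complex (ip y x) = cnj (to_complex (ip x y))"
    and inner_eq_Re_ip: "x \<bullet> y = Re (to_complex (ip x y))"

lemma hilbert_space_real:
  "hilbert_space (scaleR :: real \<Rightarrow> 'a::{real_inner, complete_space} \<Rightarrow> 'a) inner"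
  by unfold_locales
    (auto simp: to_complex_real_def inner_left_distrib inner_right_distrib inner_commute scaleR_add_right scaleR_add_left)

lemma hilbert_space_complex:
  "hilbert_space ((*) :: complex \<Rightarrow> complex \<Rightarrow> complex) (\<lambda>x y. x * cnj y)"
  by unfold_locales
    (auto simp: to_complex_complex_def algebra_simps scaleR_conv_of_real inner_complex_def)

text \<open>The scalar multiplication of \<open>\<X> \<times> \<Y>\<close>.\<close>

definition prod_scale ::
  "('k \<Rightarrow> 'x \<Rightarrow> 'x) \<Rightarrow> ('k \<Rightarrow> 'y \<Rightarrow> 'y) \<Rightarrow> 'k \<Rightarrow> 'x \<times> 'y \<Rightarrow> 'x \<times> 'y" where
  "prod_scale sX sY a v = (sX a (fst v), sY a (snd v))"

text \<open>The product type carries the Hilbert space direct sum.\<close>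

lemma hilbert_space_prod:
  assumes "hilbert_space sX ipX" and "hilbert_space sY ipY"
  shows "hilbert_space (prod_scale sX sY) (\<lambda>u v. ipX (fst u) (fst v) + ipY (snd u) (snd v))"
proof -
  interpret X: hilbert_space sX ipX by fact
  interpret Y: hilbert_space sY ipY by fact
  show ?thesis
    by unfold_locales
      (auto simp: prod_scale_def X.scale_right_distrib Y.scale_right_distrib
        X.scale_left_distrib Y.scale_left_distrib X.scale_of_real Y.scale_of_real
        X.ip_add_left Y.ip_add_left X.ip_scale_left Y.ip_scale_left to_complex_add
        X.ip_commute[symmetric] Y.ip_commute[symmetric] X.inner_eq_Re_ip Y.inner_eq_Re_ip
        inner_prod_def algebra_simps)
qed

definition linear_relation ::
  "('k::real_or_complex \<Rightarrow> 'x::ab_group_add \<Rightarrow> 'x) \<Rightarrow> ('k \<Rightarrow> 'y::ab_group_add \<Rightarrow> 'y) \<Rightarrow> ('x \<times> 'y) set \<Rightarrow> bool"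
  where "linear_relation sX sY A \<longleftrightarrow> module.subspace (prod_scale sX sY) A"

text \<open>
  The domain, the range and the product of relations are the library's \<^const>\<open>Domain\<close>,
  \<^const>\<open>Range\<close> and \<^const>\<open>relcomp\<close>; the latter is written in diagrammatic order, so that the
  product \<open>BA\<close> is \<open>A O B\<close>.
\<close>

definition rel_ker :: "('x \<times> 'y::zero) set \<Rightarrow> 'x set"
  where "rel_ker A = {x. (x, 0) \<in> A}"

definition rel_mul :: "('x::zero \<times> 'y) set \<Rightarrow> 'y set"
  where "rel_mul A = {y. (0, y) \<in> A}"

text \<open>Operators are identified with their graphs; the domain need not be the whole space.\<close>

definition bounded_linear_operator ::
  "('k::real_or_complex \<Rightarrow> 'x::real_normed_vector \<Rightarrow> 'x) \<Rightarrow> ('k \<Rightarrow> 'y::real_normed_vector \<Rightarrow> 'y)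
    \<Rightarrow> ('x \<times> 'y) set \<Rightarrow> bool" where
  "bounded_linear_operator sX sY T \<longleftrightarrow>
     linear_relation sX sY T \<and> single_valued T \<and> (\<exists>c. \<forall>(x, y) \<in> T. norm y \<le> c * norm x)"

text \<open>
  The existential quantifier over the Hilbert space \<open>\<W>\<close> ranges over Hilbert space structures on
  the type \<open>'w\<close>, which is a parameter since HOL has no quantification over types. When the
  predicate is used as a hypothesis of a theorem with \<open>'w\<close> a free type variable, the implicit
  outermost universal quantification over \<open>'w\<close> amounts to the existential quantification over all
  \<open>\<W>\<close> within the hypothesis.
\<close>

definition range_space_relation ::
  "'w::{real_inner, complete_space} itself
    \<Rightarrow> ('k::real_or_complex \<Rightarrow> 'x::real_normed_vector \<Rightarrow> 'x)
    \<Rightarrow> ('k \<Rightarrow> 'y::real_normed_vector \<Rightarrow> 'y) \<Rightarrow> ('x \<times> 'y) set \<Rightarrow> bool" where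
  "range_space_relation (_ :: 'w itself) sX sY A \<longleftrightarrow>
     linear_relation sX sY A \<and>
     (\<exists>(sW :: 'k \<Rightarrow> 'w \<Rightarrow> 'w) ipW F.
        hilbert_space sW ipW \<and> Vector_Spaces.linear sW (prod_scale sX sY) F \<and>
        bounded_linear F \<and> range F = A)"

end

theory Submission
  imports Defs
begin

text \<open>
  For the nontrivial direction, send \<open>x \<in> dom(A)\<close> to the unique \<open>y \<bottom> ker(B)\<close> with \<open>(x, z) \<in> A\<close>
  and \<open>(y, z) \<in> B\<close> for some \<open>z\<close>. If \<open>A\<close> and \<open>B\<close> are the ranges of \<open>F\<^sub>A\<close> and \<open>F\<^sub>B\<close>, the graph of
  this operator is the image of a closed subspace of pairs \<open>(u, v)\<close> under the bounded map
  \<open>(u, v) \<mapsto> (fst (F\<^sub>A u), fst (F\<^sub>B v))\<close>. The first component maps this subspace onto the closed space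
  \<open>dom(A)\<close>, so by the open mapping theorem preimages can be chosen with norm control, and the
  operator is bounded.
\<close>

section \<open>Nearest points and orthogonal projection in the real structure\<close>

text \<open>A sequence in \<open>K\<close> minimizing the distance to \<open>y\<close> is Cauchy by
  the parallelogram identity. Its limit is a nearest point, and minimality along each line through
  it forces orthogonality.\<close>

lemma orthogonal_projection_exists:
  fixes K :: "'a::{real_inner, complete_space} set"
  assumes K: "subspace K" "closed K"
  obtains k where "k \<in> K" and "\<And>u. u \<in> K \<Longrightarrow> (y - k) \<bullet> u = 0"
proof -
  define d where "d = infdist y K"
  have ne: "K \<noteq> {}" using subspace_0[OF K(1)] by auto
  have d0: "d \<ge> 0" by (simp add: d_def infdist_nonneg)
  have d_le: "d \<le> norm (y - u)" if "u \<in> K" for u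
    using infdist_le[OF that, of y] by (simp add: d_def dist_norm)
  have "\<exists>u\<in>K. norm (y - u) < d + inverse (real (Suc n))" for n
  proof (rule ccontr)
    assume "\<not> ?thesis"
    then have "d + inverse (real (Suc n)) \<le> dist y u" if "u \<in> K" for u
      using that by (auto simp: dist_norm not_less)
    then have "d + inverse (real (Suc n)) \<le> infdist y K"
      unfolding infdist_notempty[OF ne] by (intro cINF_greatest ne)
    then show False by (simp add: d_def)
  qed
  then obtain k where kK: "\<And>n. k n \<in> K"
    and k_lt: "\<And>n. norm (y - k n) < d + inverse (real (Suc n))"
    by metis
  have lim: "(\<lambda>n. norm (y - k n)) \<longlonglongrightarrow> d"
  proof (rule tendsto_sandwich)
    show "\<forall>\<^sub>F n in sequentially. d \<le> norm (y - k n)" using d_le kK by simp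
    show "\<forall>\<^sub>F n in sequentially. norm (y - k n) \<le> d + inverse (real (Suc n))"
      using k_lt by (simp add: less_imp_le)
    show "(\<lambda>n. d + inverse (real (Suc n))) \<longlonglongrightarrow> d"
      using tendsto_add[OF tendsto_const LIMSEQ_inverse_real_of_nat, of d] by simp
  qed simp
  \<comment> \<open>Parallelogram identity for \<open>y - k m\<close> and \<open>y - k n\<close>:
    half their sum is \<open>y\<close> minus the midpoint of \<open>k m\<close> and
    \<open>k n\<close>. That midpoint lies in \<open>K\<close>, so its distance from
    \<open>y\<close> is at least \<open>d\<close>.\<close>
  have par: "(norm (k m - k n))\<^sup>2 \<le> 2 * (norm (y - k m))\<^sup>2 + 2 * (norm (y - k n))\<^sup>2 - 4 * d\<^sup>2" for m n
  proof -
    have "(1/2) *\<^sub>R (k m + k n) \<in> K"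
      using kK K(1) by (intro subspace_scale subspace_add)
    then have "d\<^sup>2 \<le> (norm (y - (1/2) *\<^sub>R (k m + k n)))\<^sup>2"
      using d_le d0 by (intro power_mono) auto
    then show ?thesis
      by (simp add: power2_norm_eq_inner inner_diff inner_add inner_commute algebra_simps)
  qed
  have "Cauchy k"
  proof (rule metric_CauchyI)
    fix e :: real assume e: "e > 0"
    have "(\<lambda>n. (norm (y - k n))\<^sup>2) \<longlonglongrightarrow> d\<^sup>2" by (intro tendsto_intros lim)
    \<comment> \<open>With slack \<open>e\<^sup>2 / 4\<close> in both squared distances, the bound
      \<open>par\<close> becomes exactly \<open>e\<^sup>2\<close>.\<close>
    then have "\<forall>\<^sub>F n in sequentially. (norm (y - k n))\<^sup>2 < d\<^sup>2 + e\<^sup>2 / 4"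
      by (rule order_tendstoD) (use e in simp)
    then obtain N where N: "\<And>n. n \<ge> N \<Longrightarrow> (norm (y - k n))\<^sup>2 < d\<^sup>2 + e\<^sup>2 / 4"
      by (auto simp: eventually_sequentially)
    have "dist (k m) (k n) < e" if "m \<ge> N" "n \<ge> N" for m n
    proof -
      have "(norm (k m - k n))\<^sup>2 < e\<^sup>2"
        using par[of m n] N[OF that(1)] N[OF that(2)] by simp
      then show ?thesis using e by (simp add: dist_norm power_less_imp_less_base)
    qed
    then show "\<exists>N. \<forall>m\<ge>N. \<forall>n\<ge>N. dist (k m) (k n) < e" by blast
  qed
  then obtain l where l: "k \<longlonglongrightarrow> l" using Cauchy_convergent convergent_def by blast
  have lK: "l \<in> K" using closed_sequentially[OF K(2) _ l] kK by blast
  have "(\<lambda>n. norm (y - k n)) \<longlonglongrightarrow> norm (y - l)" by (intro tendsto_intros l)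
  then have nl: "norm (y - l) = d" using lim LIMSEQ_unique by blast
  have "(y - l) \<bullet> u = 0" if u: "u \<in> K" for u
  proof (cases "u = 0")
    case False
    have sq: "(norm (w - t *\<^sub>R u))\<^sup>2 = (norm w)\<^sup>2 - 2 * t * (w \<bullet> u) + t * (t * (u \<bullet> u))" for w t
      by (simp add: power2_norm_eq_inner inner_diff inner_commute algebra_simps)
    \<comment> \<open>This \<open>t\<close> minimizes the quadratic \<open>sq\<close> for
      \<open>w = y - l\<close>. The minimum undercuts \<open>(norm (y - l))\<^sup>2\<close> by
      \<open>t * ((y - l) \<bullet> u)\<close>, which therefore cannot be positive.\<close>
    define t where "t = ((y - l) \<bullet> u) / (u \<bullet> u)"
    have "l + t *\<^sub>R u \<in> K" using lK u K(1) by (intro subspace_add subspace_scale)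
    then have "(norm (y - l))\<^sup>2 \<le> (norm (y - (l + t *\<^sub>R u)))\<^sup>2"
      using d_le nl d0 by (intro power_mono) auto
    also have "y - (l + t *\<^sub>R u) = (y - l) - t *\<^sub>R u" by simp
    also have "(norm ((y - l) - t *\<^sub>R u))\<^sup>2 = (norm (y - l))\<^sup>2 - 2 * t * ((y - l) \<bullet> u) + t * (t * (u \<bullet> u))"
      by (rule sq)
    also have "t * (u \<bullet> u) = (y - l) \<bullet> u" using False by (simp add: t_def)
    finally have "t * ((y - l) \<bullet> u) \<le> 0" by simp
    then have "((y - l) \<bullet> u)\<^sup>2 / (u \<bullet> u) \<le> 0" by (simp add: t_def power2_eq_square)
    then show ?thesis using False
      by (metis inner_gt_zero_iff divide_le_0_iff not_less power2_eq_square zero_eq_power2 zero_le_power2 order_antisym)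
  qed simp
  then show ?thesis using that lK by blast
qed

section \<open>Open mapping with norm control on a subspace\<close>

lemma open_mapping_dense:
  fixes G :: "'a::real_normed_vector \<Rightarrow> 'b::{real_normed_vector, complete_space}"
  assumes G: "linear G" and S: "subspace S" and cl: "closed (G ` S)"
  obtains M where "M \<ge> 0"
    and "\<And>d e. d \<in> G ` S \<Longrightarrow> e > 0 \<Longrightarrow> \<exists>s\<in>S. norm s \<le> M * norm d \<and> norm (d - G s) < e"
proof -
  interpret G: linear G by fact
  define D where "D = G ` S"
  define C where "C n = closure (G ` (S \<inter> cball 0 (real n)))" for n
  let ?X = "top_of_set D"
  have D: "subspace D" unfolding D_def using assms(1,2) by (rule linear_subspace_image)
  have CD: "C n \<subseteq> D" for n
    unfolding C_def D_def by (rule closure_minimal) (use cl in auto)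
  have "D \<subseteq> (\<Union>n. C n)"
  proof
    fix x assume "x \<in> D"
    then obtain s where s: "s \<in> S" "x = G s" by (auto simp: D_def)
    obtain n where "norm s \<le> real n" using real_arch_simple by blast
    then have "x \<in> C n" unfolding C_def using s closure_subset by fastforce
    then show "x \<in> (\<Union>n. C n)" by blast
  qed
  then have UC: "(\<Union>n. C n) = D" using CD by blast
  have "\<exists>n. ?X interior_of C n \<noteq> {}"
  proof (rule ccontr)
    assume "\<not> ?thesis"
    moreover have "closedin ?X (C n)" for n
      using CD by (simp add: C_def closed_subset)
    moreover have "completely_metrizable_space ?X"
      using cl completely_metrizable_space_closedin[OF completely_metrizable_space_euclidean, of D]
      by (simp add: D_def)
    \<comment> \<open>By Baire, countably many closed sets without interior would have a union
      without interior; but the union is the nonempty whole space \<open>D\<close>.\<close>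
    ultimately have "?X interior_of \<Union>(range C) = {}"
      by (intro Baire_category_alt) auto
    then show False
      using UC subspace_0[OF D] interior_of_topspace[of ?X] by auto
  qed
  then obtain n x0 where "x0 \<in> ?X interior_of C n" by blast
  then obtain T where T: "openin ?X T" "x0 \<in> T" "T \<subseteq> C n" by (auto simp: interior_of_def)
  then obtain r where r: "r > 0" "\<And>x. x \<in> D \<Longrightarrow> dist x x0 < r \<Longrightarrow> x \<in> C n" and x0: "x0 \<in> D"
    unfolding openin_euclidean_subtopology_iff by blast
  \<comment> \<open>Moves the ball from \<open>x0\<close> to the origin: \<open>x0 + d\<close> and
    \<open>x0\<close> are both approximated within \<open>e / 2\<close> from the ball of radius
    \<open>n\<close>, and subtracting the approximants doubles the radius.\<close>
  have near: "\<exists>s\<in>S. norm s \<le> 2 * real n \<and> norm (d - G s) < e"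
    if d: "d \<in> D" "norm d < r" and e: "e > 0" for d e
  proof -
    have "x0 + d \<in> C n" using r(2)[of "x0 + d"] subspace_add[OF D x0 d(1)] d(2) by (simp add: dist_norm)
    then obtain s where s: "s \<in> S" "norm s \<le> real n" "norm (G s - (x0 + d)) < e / 2"
      unfolding C_def closure_approachable using e by (force simp: dist_norm dest: spec[of _ "e/2"])
    have "x0 \<in> C n" using r x0 by simp
    then obtain s' where s': "s' \<in> S" "norm s' \<le> real n" "norm (G s' - x0) < e / 2"
      unfolding C_def closure_approachable using e by (force simp: dist_norm dest: spec[of _ "e/2"])
    have "d - G (s - s') = (G s' - x0) - (G s - (x0 + d))" by (simp add: G.diff)
    then have "norm (d - G (s - s')) = norm ((G s' - x0) - (G s - (x0 + d)))" by (rule arg_cong)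
    then have "norm (d - G (s - s')) < e"
      using norm_triangle_ineq4[of "G s' - x0" "G s - (x0 + d)"] s(3) s'(3) by linarith
    moreover have "norm (s - s') \<le> 2 * real n" using norm_triangle_ineq4[of s s'] s(2) s'(2) by simp
    ultimately show ?thesis using subspace_diff[OF S s(1) s'(1)] by blast
  qed
  \<comment> \<open>Rescaling \<open>d\<close> by \<open>c = r / (2 * norm d)\<close> brings its
    norm to \<open>r / 2\<close>; dividing the bound \<open>2 * real n\<close> by \<open>c\<close>
    afterwards gives \<open>M * norm d\<close>. The tolerance \<open>c * e\<close> becomes
    \<open>e\<close> in the same way.\<close>
  define M where "M = 4 * real n / r"
  show ?thesis
  proof
    show "M \<ge> 0" using r(1) by (simp add: M_def)
    fix d e assume d: "d \<in> G ` S" and e: "(e::real) > 0"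
    show "\<exists>s\<in>S. norm s \<le> M * norm d \<and> norm (d - G s) < e"
    proof (cases "d = 0")
      case True
      then show ?thesis using e subspace_0[OF S] by (intro bexI[of _ 0]) (auto simp: G.zero)
    next
      case False
      define c where "c = r / (2 * norm d)"
      have c: "c > 0" using False r(1) by (simp add: c_def)
      have "norm (c *\<^sub>R d) < r" using False r(1) by (simp add: c_def)
      moreover have "c *\<^sub>R d \<in> D" using d D by (simp add: D_def subspace_scale)
      ultimately obtain s where s: "s \<in> S" "norm s \<le> 2 * real n" "norm (c *\<^sub>R d - G s) < c * e"
        using near[of "c *\<^sub>R d" "c * e"] c e by auto
      have "d - G (s /\<^sub>R c) = (c *\<^sub>R d - G s) /\<^sub>R c"
        using c by (simp add: G.scaleR scaleR_diff_right)
      then have "norm (d - G (s /\<^sub>R c)) = norm (c *\<^sub>R d - G s) / c"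
        using c by (simp only: norm_scaleR) (simp add: field_simps)
      then have "norm (d - G (s /\<^sub>R c)) < e"
        using s(3) c by (simp only: divide_less_eq mult.commute) simp
      moreover have "norm (s /\<^sub>R c) \<le> M * norm d"
      proof -
        have "norm (s /\<^sub>R c) = norm s / c" using c by (simp add: divide_inverse mult.commute)
        also have "\<dots> \<le> 2 * real n / c" using s(2) c by (intro divide_right_mono) auto
        also have "\<dots> = M * norm d" using False r(1) by (simp add: c_def M_def)
        finally show ?thesis .
      qed
      ultimately show ?thesis using subspace_scale[OF S s(1)] by blast
    qed
  qed
qed

text \<open>Exact preimages arise by successive approximation: each correction halves the residual,
  so the corrections form a geometrically dominated series. It converges in the closed
  \<open>S\<close>, and continuity of \<open>G\<close> identifies the image of its sum.\<close>

lemma open_mapping_closed_subspace: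
  fixes G :: "'a::{real_normed_vector, complete_space} \<Rightarrow> 'b::{real_normed_vector, complete_space}"
  assumes G: "bounded_linear G" and S: "subspace S" "closed S" and cl: "closed (G ` S)"
  obtains M where "\<And>d. d \<in> G ` S \<Longrightarrow> \<exists>s\<in>S. G s = d \<and> norm s \<le> M * norm d"
proof -
  interpret G: bounded_linear G by fact
  obtain M where M: "M \<ge> 0"
    and dense: "\<And>d e. d \<in> G ` S \<Longrightarrow> e > 0 \<Longrightarrow> \<exists>s\<in>S. norm s \<le> M * norm d \<and> norm (d - G s) < e"
    using open_mapping_dense[OF G.linear S(1) cl] by blast
  have D: "subspace (G ` S)" using G.linear S(1) by (rule linear_subspace_image)
  \<comment> \<open>The case \<open>d = 0\<close> is separate because the tolerance
    \<open>norm d / 2\<close> must be positive.\<close>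
  have "\<exists>s\<in>S. norm s \<le> M * norm d \<and> norm (d - G s) \<le> norm d / 2" if d: "d \<in> G ` S" for d
  proof (cases "d = 0")
    case True
    then show ?thesis using subspace_0[OF S(1)] by (intro bexI[of _ 0]) (auto simp: G.zero)
  next
    case False
    then show ?thesis using dense[OF d, of "norm d / 2"] by (auto intro: less_imp_le)
  qed
  then obtain f where f: "\<And>d. d \<in> G ` S \<Longrightarrow> f d \<in> S"
    "\<And>d. d \<in> G ` S \<Longrightarrow> norm (f d) \<le> M * norm d"
    "\<And>d. d \<in> G ` S \<Longrightarrow> norm (d - G (f d)) \<le> norm d / 2"
    by metis
  show ?thesis
  proof
    fix d assume d: "d \<in> G ` S"
    \<comment> \<open>\<open>r n\<close> is the residual left after \<open>n\<close> corrections,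
      and the partial sums \<open>P n\<close> below collect these corrections, so that
      \<open>G (P n) = d - r n\<close> telescopes.\<close>
    define r where "r n = ((\<lambda>d. d - G (f d)) ^^ n) d" for n
    have r0: "r 0 = d" and rS: "\<And>n. r (Suc n) = r n - G (f (r n))" by (simp_all add: r_def)
    have rD: "r n \<in> G ` S" for n
      by (induction n) (use d f(1) D in \<open>auto simp: r0 rS intro!: subspace_diff\<close>)
    have rn: "norm (r n) \<le> norm d * (1/2) ^ n" for n
    proof (induction n)
      case (Suc n)
      then show ?case using f(3)[OF rD[of n]] by (simp add: rS)
    qed (simp add: r0)
    define P where "P n = (\<Sum>k<n. f (r k))" for n
    define a where "a k = M * norm d * (1/2) ^ k" for k :: nat
    have fa: "norm (f (r k)) \<le> a k" for k
      using order_trans[OF f(2)[OF rD] mult_left_mono[OF rn M]] by (simp add: a_def mult.assoc)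
    \<comment> \<open>The geometric series with ratio 1/2 sums to 2, whence the final constant
      \<open>2 * M\<close>.\<close>
    have a_sums: "a sums (2 * M * norm d)"
      using sums_mult[OF geometric_sums[of "1/2::real"], of "M * norm d"] by (simp add: a_def[abs_def] mult_ac)
    have PS: "P n \<in> S" for n unfolding P_def using f(1) rD by (intro subspace_sum S(1)) auto
    have GP: "G (P n) = d - r n" for n
      by (induction n) (simp_all add: P_def r0 rS G.zero G.add)
    have a_nonneg: "a k \<ge> 0" for k using M by (simp add: a_def)
    have Pn: "norm (P n) \<le> 2 * M * norm d" for n
    proof -
      have "norm (P n) \<le> (\<Sum>k<n. a k)" unfolding P_def by (rule sum_norm_le) (rule fa)
      also have "\<dots> \<le> 2 * M * norm d"
        using sum_le_suminf[OF sums_summable[OF a_sums], of "{..<n}"] a_nonneg sums_unique[OF a_sums] by simp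
      finally show ?thesis .
    qed
    have "Cauchy P"
    proof (rule CauchyI')
      fix e :: real assume "e > 0"
      then obtain N where N: "\<And>m n. m \<ge> N \<Longrightarrow> norm (sum a {m..<n}) < e"
        using sums_summable[OF a_sums] unfolding summable_Cauchy by blast
      have "norm (P m - P n) < e" if "m \<ge> N" "m < n" for m n
      proof -
        have "P n - P m = sum (\<lambda>k. f (r k)) {m..<n}"
          unfolding P_def using sum_diff_nat_ivl[of 0 m n "\<lambda>k. f (r k)"] that by (simp add: lessThan_atLeast0)
        then have "norm (P m - P n) \<le> sum a {m..<n}"
          using sum_norm_le[of "{m..<n}" "\<lambda>k. f (r k)" a] fa by (simp add: norm_minus_commute[of "P m"])
        then show ?thesis using N[OF that(1), of n] by simp
      qed
      then show "\<exists>N. \<forall>m\<ge>N. \<forall>n>m. dist (P m) (P n) < e" by (auto simp: dist_norm)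
    qed
    then obtain s where s: "P \<longlonglongrightarrow> s" using Cauchy_convergent convergent_def by blast
    have sS: "s \<in> S" using closed_sequentially[OF S(2) _ s] PS by blast
    have "norm s \<le> 2 * M * norm d"
      by (rule tendsto_upperbound[OF tendsto_norm[OF s]]) (use Pn in auto)
    moreover have "G s = d"
    proof -
      have "(\<lambda>n. norm d * (1/2) ^ n) \<longlonglongrightarrow> 0"
        by (rule tendsto_mult_right_zero) (simp add: LIMSEQ_power_zero)
      then have "r \<longlonglongrightarrow> 0" by (rule Lim_null_comparison[rotated]) (use rn in simp)
      then have "(\<lambda>n. d - r n) \<longlonglongrightarrow> d - 0" by (intro tendsto_intros)
      moreover have "(\<lambda>n. d - r n) \<longlonglongrightarrow> G s" using G.tendsto[OF s] by (simp add: GP)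
      ultimately show ?thesis using LIMSEQ_unique by fastforce
    qed
    ultimately show "\<exists>s\<in>S. G s = d \<and> norm s \<le> (2 * M) * norm d" using sS by blast
  qed
qed

section \<open>Real orthogonality under scalars of the field\<close>

text \<open>Moving \<open>a\<close> out of both arguments of \<open>ip\<close> leaves
  \<open>a\<close> times its conjugate, a real factor that passes through the real part.\<close>

lemma (in hilbert_space) inner_scale_scale:
  "scale a x \<bullet> scale a y = (norm a)\<^sup>2 * (x \<bullet> y)"
proof -
  have right: "to_complex (ip x (scale a y)) = cnj (to_complex a) * to_complex (ip x y)"
    by (subst ip_commute[of x "scale a y"]) (simp add: ip_scale_left to_complex_mult ip_commute[of x y])
  have "to_complex (ip (scale a x) (scale a y)) = to_complex a * cnj (to_complex a) * to_complex (ip x y)"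
    by (simp add: ip_scale_left to_complex_mult right)
  also have "\<dots> = of_real ((norm a)\<^sup>2) * to_complex (ip x y)"
    by (simp add: complex_norm_square[symmetric] norm_to_complex)
  finally show ?thesis by (simp add: inner_eq_Re_ip)
qed

text \<open>Orthogonality to a scale-invariant \<open>K\<close> for the real inner product survives
  scalars of \<open>'k\<close>: for \<open>a \<noteq> 0\<close>, the element \<open>u\<close> is
  \<open>a\<close> times another element of \<open>K\<close>, and \<open>inner_scale_scale\<close>
  applies.\<close>

lemma (in hilbert_space) orthogonal_complement_scale:
  assumes K: "\<And>c u. u \<in> K \<Longrightarrow> scale c u \<in> K"
    and p: "\<And>u. u \<in> K \<Longrightarrow> p \<bullet> u = 0" and u: "u \<in> K"
  shows "scale a p \<bullet> u = 0"
proof (cases "a = 0")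
  case False
  then have "scale a p \<bullet> u = scale a p \<bullet> scale a (scale (inverse a) u)" by simp
  also have "\<dots> = 0" unfolding inner_scale_scale using p[OF K[OF u]] by simp
  finally show ?thesis .
qed simp

lemma linear_relation_iff:
  assumes "hilbert_space sX ipX" "hilbert_space sY ipY"
  shows "linear_relation sX sY A \<longleftrightarrow>
    (0, 0) \<in> A \<and> (\<forall>x y x' y'. (x, y) \<in> A \<longrightarrow> (x', y') \<in> A \<longrightarrow> (x + x', y + y') \<in> A)
    \<and> (\<forall>a x y. (x, y) \<in> A \<longrightarrow> (sX a x, sY a y) \<in> A)"
proof -
  interpret P: hilbert_space "prod_scale sX sY" "\<lambda>u v. ipX (fst u) (fst v) + ipY (snd u) (snd v)"
    using assms by (rule hilbert_space_prod)
  show ?thesis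
    unfolding linear_relation_def P.subspace_def zero_prod_def
    by (simp add: Ball_def prod_scale_def)
qed

section \<open>Factorization through the operator with values orthogonal to the kernel\<close>

theorem theorem2p4:
  fixes sX :: "'k::real_or_complex \<Rightarrow> 'x::{real_inner, complete_space} \<Rightarrow> 'x"
    and sY :: "'k \<Rightarrow> 'y::{real_inner, complete_space} \<Rightarrow> 'y"
    and sZ :: "'k \<Rightarrow> 'z::{real_inner, complete_space} \<Rightarrow> 'z"
    and ipX :: "'x \<Rightarrow> 'x \<Rightarrow> 'k" and ipY :: "'y \<Rightarrow> 'y \<Rightarrow> 'k" and ipZ :: "'z \<Rightarrow> 'z \<Rightarrow> 'k"
    and A :: "('x \<times> 'z) set" and B :: "('y \<times> 'z) set"
  assumes "hilbert_space sX ipX" and "hilbert_space sY ipY" and "hilbert_space sZ ipZ"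
    and "separable_space (euclidean :: 'x topology)"
    and "separable_space (euclidean :: 'y topology)"
    and "separable_space (euclidean :: 'z topology)"
    and "range_space_relation TYPE('v::{real_inner, complete_space}) sX sZ A"
    and "range_space_relation TYPE('w::{real_inner, complete_space}) sY sZ B"
    and "closed (Domain A)" and "closed (Range B)" and "closed (rel_ker B)"
  shows "(\<exists>T :: ('x \<times> 'y) set. bounded_linear_operator sX sY T \<and> A = T O B) \<longleftrightarrow>
    Range A \<subseteq> Range B \<and> rel_mul B = rel_mul A"
proof -
  interpret X: hilbert_space sX ipX by fact
  interpret Y: hilbert_space sY ipY by fact
  interpret Z: hilbert_space sZ ipZ by fact
  note XZ = linear_relation_iff[OF assms(1,3)] and YZ = linear_relation_iff[OF assms(2,3)]
    and XY = linear_relation_iff[OF assms(1,2)]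
  obtain FA :: "'v \<Rightarrow> 'x \<times> 'z" where linA: "linear_relation sX sZ A" and FA: "bounded_linear FA" "range FA = A"
    using assms(7) unfolding range_space_relation_def by blast
  obtain FB :: "'w \<Rightarrow> 'y \<times> 'z" where linB: "linear_relation sY sZ B" and FB: "bounded_linear FB" "range FB = B"
    using assms(8) unfolding range_space_relation_def by blast
  interpret FA: bounded_linear FA by fact
  interpret FB: bounded_linear FB by fact
  have A0: "(0, 0) \<in> A" and A_add: "\<And>x y x' y'. (x, y) \<in> A \<Longrightarrow> (x', y') \<in> A \<Longrightarrow> (x + x', y + y') \<in> A"
    and A_scale: "\<And>a x y. (x, y) \<in> A \<Longrightarrow> (sX a x, sZ a y) \<in> A"
    using linA unfolding XZ by blast+
  have B0: "(0, 0) \<in> B" and B_add: "\<And>x y x' y'. (x, y) \<in> B \<Longrightarrow> (x', y') \<in> B \<Longrightarrow> (x + x', y + y') \<in> B"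
    and B_scale: "\<And>a x y. (x, y) \<in> B \<Longrightarrow> (sY a x, sZ a y) \<in> B"
    using linB unfolding YZ by blast+
  have A_diff: "(x - x', y - y') \<in> A" if "(x, y) \<in> A" "(x', y') \<in> A" for x y x' y'
    using A_add[OF that(1) A_scale[OF that(2), of "- 1"]] by simp
  have B_diff: "(x - x', y - y') \<in> B" if "(x, y) \<in> B" "(x', y') \<in> B" for x y x' y'
    using B_add[OF that(1) B_scale[OF that(2), of "- 1"]] by simp
  define K where "K = rel_ker B"
  have K_iff: "k \<in> K \<longleftrightarrow> (k, 0) \<in> B" for k by (simp add: K_def rel_ker_def)
  have K_scale: "sY a k \<in> K" if "k \<in> K" for a k
    using B_scale[of k 0 a] that by (simp add: K_iff)
  \<comment> \<open>The projection lemma uses the real structure, so real multiples are read as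
    multiples by \<open>of_real c\<close>.\<close>
  have subK: "subspace K"
    unfolding subspace_def
  proof (intro conjI ballI allI)
    fix c :: real and k assume "k \<in> K"
    then show "c *\<^sub>R k \<in> K" using K_scale[of k "of_real c"] by (simp add: Y.scale_of_real)
  qed (use B0 B_add[where y = 0 and y' = 0] in \<open>auto simp: K_iff\<close>)
  have clK: "closed K" using assms(11) by (simp add: K_def)
  show ?thesis
  proof
    assume "\<exists>T :: ('x \<times> 'y) set. bounded_linear_operator sX sY T \<and> A = T O B"
    then obtain T :: "('x \<times> 'y) set" where T: "linear_relation sX sY T" "single_valued T" "A = T O B"
      by (auto simp: bounded_linear_operator_def)
    have "(0, 0) \<in> T" using T(1) by (simp add: XY)
    \<comment> \<open>Since \<open>T\<close> relates 0 only to 0, composing with \<open>B\<close>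
      leaves the multivalued part of \<open>B\<close> unchanged.\<close>
    then have "y = 0" if "(0, y) \<in> T" for y using single_valuedD[OF T(2)] that by blast
    with \<open>(0, 0) \<in> T\<close> have "(0, z) \<in> T O B \<longleftrightarrow> (0, z) \<in> B" for z by blast
    then have "rel_mul B = rel_mul A" by (simp add: rel_mul_def T(3))
    moreover have "Range A \<subseteq> Range B" unfolding T(3) by blast
    ultimately show "Range A \<subseteq> Range B \<and> rel_mul B = rel_mul A" by blast
  next
    assume "Range A \<subseteq> Range B \<and> rel_mul B = rel_mul A"
    then have ran: "Range A \<subseteq> Range B" and mul: "\<And>z. (0, z) \<in> B \<longleftrightarrow> (0, z) \<in> A"
      by (auto simp: rel_mul_def)
    define T where "T = {(x, y). (\<forall>k\<in>K. y \<bullet> k = 0) \<and> (\<exists>z. (x, z) \<in> A \<and> (y, z) \<in> B)}"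
    have T_ex: "\<exists>y. (\<forall>k\<in>K. y \<bullet> k = 0) \<and> (y, z) \<in> B" if xz: "(x, z) \<in> A" for x z
    proof -
      obtain y where y: "(y, z) \<in> B" using xz ran by blast
      obtain k where k: "k \<in> K" "\<And>u. u \<in> K \<Longrightarrow> (y - k) \<bullet> u = 0"
        using orthogonal_projection_exists[OF subK clK] by blast
      \<comment> \<open>Removing the kernel component of \<open>y\<close> does not change the
        related \<open>z\<close>.\<close>
      have "(y - k, z) \<in> B" using B_diff[OF y, of k 0] k(1) by (simp add: K_iff)
      then show ?thesis using k(2) by blast
    qed
    have T_single: "y = y'" if T: "(x, y) \<in> T" "(x, y') \<in> T" for x y y'
    proof -
      obtain z z' where z: "(x, z) \<in> A" "(y, z) \<in> B" "(x, z') \<in> A" "(y', z') \<in> B"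
        using T by (auto simp: T_def)
      \<comment> \<open>Two choices of \<open>z\<close> differ by an element of mul(A) = mul(B).
        Subtracting \<open>(0, z - z')\<close> inside \<open>B\<close> puts \<open>y - y'\<close>
        into \<open>K\<close>, to which it is also orthogonal.\<close>
      have "(0, z - z') \<in> B" using A_diff[OF z(1,3)] mul by simp
      then have "(y - y', 0) \<in> B" using B_diff[OF B_diff[OF z(2,4)]] by fastforce
      moreover have "(y - y') \<bullet> k = 0" if "k \<in> K" for k
        using T that by (simp add: T_def inner_diff_left)
      ultimately have "(y - y') \<bullet> (y - y') = 0" using K_iff by blast
      then show ?thesis by simp
    qed
    have linT: "linear_relation sX sY T"
      unfolding XY
    proof (intro conjI allI impI)
      show "(0, 0) \<in> T" using A0 B0 by (auto simp: T_def)
      show "(x + x', y + y') \<in> T" if "(x, y) \<in> T" "(x', y') \<in> T" for x y x' y'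
        using that A_add B_add by (fastforce simp: T_def inner_add_left)
      show "(sX a x, sY a y) \<in> T" if "(x, y) \<in> T" for a x y
        using that A_scale B_scale Y.orthogonal_complement_scale[of K y, OF K_scale]
        by (fastforce simp: T_def)
    qed
    have "A = T O B"
    proof (intro set_eqI iffI; clarify)
      fix x z assume "(x, z) \<in> A"
      then show "(x, z) \<in> T O B" using T_ex by (fastforce simp: T_def)
    next
      fix x y z assume "(x, y) \<in> T" and yz: "(y, z) \<in> B"
      then obtain z' where z': "(x, z') \<in> A" "(y, z') \<in> B" by (auto simp: T_def)
      \<comment> \<open>Here the equality of the multivalued parts is used from \<open>B\<close> to
        \<open>A\<close>: the discrepancy between \<open>z\<close> and \<open>z'\<close> can be
        added to \<open>(x, z')\<close> within \<open>A\<close>.\<close>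
      have "(0, z - z') \<in> A" using B_diff[OF yz z'(2)] mul by simp
      then show "(x, z) \<in> A" using A_add[OF z'(1)] by fastforce
    qed
    moreover have "\<exists>c. \<forall>(x, y)\<in>T. norm y \<le> c * norm x"
    proof -
      define S where "S = {w. snd (FA (fst w)) = snd (FB (snd w)) \<and> (\<forall>k\<in>K. fst (FB (snd w)) \<bullet> k = 0)}"
      define G where "G w = fst (FA (fst w))" for w :: "'v \<times> 'w"
      have blA: "bounded_linear (\<lambda>w :: 'v \<times> 'w. FA (fst w))"
        and blB: "bounded_linear (\<lambda>w :: 'v \<times> 'w. FB (snd w))"
        using bounded_linear_compose[OF FA(1) bounded_linear_fst]
          bounded_linear_compose[OF FB(1) bounded_linear_snd] by blast+
      have blG: "bounded_linear G"
        unfolding G_def by (rule bounded_linear_compose[OF bounded_linear_fst blA])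
      have blH: "bounded_linear (\<lambda>w :: 'v \<times> 'w. fst (FB (snd w)))"
        by (rule bounded_linear_compose[OF bounded_linear_fst blB])
      have subS: "subspace S"
        by (auto simp: S_def subspace_def FA.zero FB.zero FA.add FB.add FA.scaleR FB.scaleR inner_add_left)
      have clS: "closed S"
      proof -
        note cont = linear_continuous_on[OF blA, of UNIV] linear_continuous_on[OF blB, of UNIV]
        \<comment> \<open>Every condition equates two continuous functions of \<open>w\<close>, so
          \<open>S\<close> is an intersection of closed sets.\<close>
        have "S = {w. snd (FA (fst w)) = snd (FB (snd w))} \<inter> (\<Inter>k\<in>K. {w. fst (FB (snd w)) \<bullet> k = 0})"
          by (auto simp: S_def)
        then show ?thesis
          by (simp only:) (intro closed_Int closed_INT ballI closed_Collect_eq continuous_intros cont)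
      qed
      have im: "\<exists>w\<in>S. G w = x \<and> fst (FB (snd w)) = y" if "(x, y) \<in> T" for x y
      proof -
        obtain z where z: "(x, z) \<in> A" "(y, z) \<in> B" using \<open>(x, y) \<in> T\<close> by (auto simp: T_def)
        obtain u where u: "FA u = (x, z)" using z(1) FA(2) by (metis imageE)
        obtain v where v: "FB v = (y, z)" using z(2) FB(2) by (metis imageE)
        have "(u, v) \<in> S" using u v \<open>(x, y) \<in> T\<close> by (simp add: S_def T_def)
        then show ?thesis using u v by (force simp: G_def)
      qed
      have GT: "(G w, fst (FB (snd w))) \<in> T" if "w \<in> S" for w
      proof -
        have "FA (fst w) \<in> A" "FB (snd w) \<in> B" using FA(2) FB(2) by auto
        then show ?thesis using that unfolding S_def T_def G_def
          by (cases "FA (fst w)"; cases "FB (snd w)") auto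
      qed
      \<comment> \<open>The closedness of dom(A) enters here, as the closed image required by the
        open mapping lemma.\<close>
      have "Domain T = Domain A" using T_ex by (fastforce simp: T_def)
      moreover have "G ` S = Domain T" using im GT by fastforce
      ultimately have "closed (G ` S)" using assms(9) by simp
      then obtain M where M: "\<And>d. d \<in> G ` S \<Longrightarrow> \<exists>s\<in>S. G s = d \<and> norm s \<le> M * norm d"
        using open_mapping_closed_subspace[OF blG subS clS] by blast
      obtain c where c: "c > 0" "\<And>w :: 'v \<times> 'w. norm (fst (FB (snd w))) \<le> norm w * c"
        using bounded_linear.pos_bounded[OF blH] by blast
      have "norm y \<le> (c * M) * norm x" if xy: "(x, y) \<in> T" for x y
      proof -
        obtain s where s: "s \<in> S" "G s = x" "norm s \<le> M * norm x" using im[OF xy] M by blast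
        \<comment> \<open>The norm-controlled \<open>s\<close> was chosen only by its first
          component \<open>x\<close>; single-valuedness of \<open>T\<close> makes its second
          component equal to \<open>y\<close>.\<close>
        have "y = fst (FB (snd s))" using T_single[OF xy] GT[OF s(1)] s(2) by simp
        then have "norm y \<le> norm s * c" using c(2) by simp
        also have "\<dots> \<le> M * norm x * c" using s(3) c(1) by (intro mult_right_mono) auto
        finally show ?thesis by (simp add: mult_ac)
      qed
      then show ?thesis by blast
    qed
    moreover have "single_valued T" using T_single by (auto intro: single_valuedI)
    ultimately show "\<exists>T :: ('x \<times> 'y) set. bounded_linear_operator sX sY T \<and> A = T O B"
      using linT unfolding bounded_linear_operator_def by blast
  qed
qed

end
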